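(* Let $(\Omega,\sigma)$ be minimal and let $f\in C^{0,1}(\Omega\times\mathbb{R},\mathbb{R})$ be $(\mathrm{Co})$ and such that there exists only one $\tau_\lambda$-minimal set for all $\lambda\in\mathbb{R}$, where $\tau_\lambda$ is the flow given by $x'=f(\omega\cdot t,x)+\lambda$. Let $\mathcal{A}_\lambda=\bigcup_{\omega\in\Omega}(\{\omega\}\times[\alpha_\lambda(\omega),\beta_\lambda(\omega)])$ be the global attractor of $\tau_\lambda$. Then $\mathcal{A}_\lambda$ is pinched for all $\lambda\in\mathbb{R}$, and $\mathcal{A}_\lambda<\mathcal{A}_\xi$ (i.e., $\beta_\lambda(\omega)<\alpha_\xi(\omega)$ for all $\omega\in\Omega$) if $\lambda<\xi$.
   Context: $\Omega$ is a compact metric space with a continuous flow $\sigma:\mathbb{R}\times\Omega\to\Omega$, $\sigma(t,\omega)=\omega\cdot t$; minimal means every $\sigma$-orbit is dense. $C^{0,1}(\Omega\times\mathbb{R},\mathbb{R})$: functions $f$ such that $f$ and $f_x$ exist and are jointly continuous. $t\mapsto u_\lambda(t,\omega,x_0)$ is the maximal solution of $x'=f(\omega\cdot t,x)+\lambda$ with $u_\lambda(0,\omega,x_0)=x_0$, and $\tau_\lambda(t,\omega,x_0)=(\omega\cdot t,u_\lambda(t,\omega,x_0))$. A $\tau_\lambda$-minimal set is a nonempty compact $\tau_\lambda$-invariant subset of $\Omega\times\mathbb{R}$ containing properly no other such set. $f$ is $(\mathrm{Co})$ (coercive) if $\lim_{|x|\to\infty}f(\omega,x)/x=-\infty$ uniformly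 on $\Omega$. Under this condition $\tau_\lambda$ has a global attractor $\mathcal{A}_\lambda$, i.e., a compact $\tau_\lambda$-invariant set attracting every bounded set in the Hausdorff semidistance, of the displayed form. A compact invariant set $\mathcal{K}\subset\Omega\times\mathbb{R}$ is pinched if there exists $\omega\in\Omega$ such that $\{x:(\omega,x)\in\mathcal{K}\}$ is a singleton. *)

theory Defs
  imports "HOL-Analysis.Analysis"
begin

definition continuous_flow :: "(real \<Rightarrow> 'w::metric_space \<Rightarrow> 'w) \<Rightarrow> bool" where
  "continuous_flow \<sigma> \<longleftrightarrow>
     (\<forall>\<omega>. \<sigma> 0 \<omega> = \<omega>) \<and>
     (\<forall>s t \<omega>. \<sigma> (s + t) \<omega> = \<sigma> s (\<sigma> t \<omega>)) \<and>
     continuous_on UNIV (\<lambda>(t, \<omega>). \<sigma> t \<omega>)"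

definition minimal_flow :: "(real \<Rightarrow> 'w::metric_space \<Rightarrow> 'w) \<Rightarrow> bool" where
  "minimal_flow \<sigma> \<longleftrightarrow> (\<forall>\<omega>. closure (range (\<lambda>t. \<sigma> t \<omega>)) = UNIV)"

definition class_C01 :: "('w::metric_space \<times> real \<Rightarrow> real) \<Rightarrow> bool" where
  "class_C01 f \<longleftrightarrow> continuous_on UNIV f \<and>
     (\<exists>fx. (\<forall>\<omega> x. ((\<lambda>y. f (\<omega>, y)) has_real_derivative fx (\<omega>, x)) (at x)) \<and>
           continuous_on UNIV fx)"

text \<open>On the real line, the filter \<^const>\<open>at_infinity\<close> expresses \<open>\<bar>x\<bar> \<rightarrow> \<infinity>\<close>.\<close>

definition coercive :: "('w \<times> real \<Rightarrow> real) \<Rightarrow> bool" where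
  "coercive f \<longleftrightarrow> (\<forall>M. eventually (\<lambda>x. \<forall>\<omega>. f (\<omega>, x) / x < M) at_infinity)"

text \<open>The parameter of the family is written \<open>\<mu>\<close>, as \<open>\<lambda>\<close> is the abstraction symbol.
  \<open>solution_on\<close> says that \<open>u\<close> solves \<open>x' = f(\<omega>\<cdot>t, x) + \<mu>\<close>, \<open>x(0) = x\<^sub>0\<close>, 
  on the open interval \<open>J\<close>.\<close>

definition solution_on ::
  "('w \<times> real \<Rightarrow> real) \<Rightarrow> (real \<Rightarrow> 'w \<Rightarrow> 'w) \<Rightarrow> real \<Rightarrow> 'w \<Rightarrow> real \<Rightarrow> real set \<Rightarrow> (real \<Rightarrow> real) \<Rightarrow> bool"
where
  "solution_on f \<sigma> \<mu> \<omega> x\<^sub>0 J u \<longleftrightarrow>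
     open J \<and> is_interval J \<and> 0 \<in> J \<and> u 0 = x\<^sub>0 \<and>
     (\<forall>t\<in>J. (u has_real_derivative f (\<sigma> t \<omega>, u t) + \<mu>) (at t))"

text \<open>For \<open>f\<close> of class \<open>C\<^sup>0\<^sup>,\<^sup>1\<close>, any two solutions of the same initial value problem agree
  on the intersection of their intervals. So the maximal solution lives on the union of all
  these intervals, and its value at \<open>t\<close> is the common value of all solutions defined
  at \<open>t\<close>. Outside \<open>max_interval\<close> the value of \<open>max_sol\<close> is meaningless.\<close>

definition max_interval ::
  "('w \<times> real \<Rightarrow> real) \<Rightarrow> (real \<Rightarrow> 'w \<Rightarrow> 'w) \<Rightarrow> real \<Rightarrow> 'w \<Rightarrow> real \<Rightarrow> real set" where
  "max_interval f \<sigma> \<mu> \<omega> x\<^sub>0 = \<Union>{J. \<exists>u. solution_on f \<sigma> \<mu> \<omega> x\<^sub>0 J u}"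

definition max_sol ::
  "('w \<times> real \<Rightarrow> real) \<Rightarrow> (real \<Rightarrow> 'w \<Rightarrow> 'w) \<Rightarrow> real \<Rightarrow> real \<Rightarrow> 'w \<Rightarrow> real \<Rightarrow> real" where
  "max_sol f \<sigma> \<mu> t \<omega> x\<^sub>0 = (THE y. \<exists>J u. solution_on f \<sigma> \<mu> \<omega> x\<^sub>0 J u \<and> t \<in> J \<and> u t = y)"

definition skew_flow ::
  "('w \<times> real \<Rightarrow> real) \<Rightarrow> (real \<Rightarrow> 'w \<Rightarrow> 'w) \<Rightarrow> real \<Rightarrow> real \<Rightarrow> 'w \<times> real \<Rightarrow> 'w \<times> real" where
  "skew_flow f \<sigma> \<mu> t = (\<lambda>(\<omega>, x\<^sub>0). (\<sigma> t \<omega>, max_sol f \<sigma> \<mu> t \<omega> x\<^sub>0))"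

text \<open>The flow \<open>skew_flow f \<sigma> \<mu>\<close> is in general only local, so definedness is stated
  explicitly.\<close>

definition flow_defined_at ::
  "('w \<times> real \<Rightarrow> real) \<Rightarrow> (real \<Rightarrow> 'w \<Rightarrow> 'w) \<Rightarrow> real \<Rightarrow> real \<Rightarrow> ('w \<times> real) set \<Rightarrow> bool" where
  "flow_defined_at f \<sigma> \<mu> t C \<longleftrightarrow> (\<forall>(\<omega>, x)\<in>C. t \<in> max_interval f \<sigma> \<mu> \<omega> x)"

definition invariant_set ::
  "('w \<times> real \<Rightarrow> real) \<Rightarrow> (real \<Rightarrow> 'w \<Rightarrow> 'w) \<Rightarrow> real \<Rightarrow> ('w \<times> real) set \<Rightarrow> bool" where
  "invariant_set f \<sigma> \<mu> K \<longleftrightarrow>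
     (\<forall>t. flow_defined_at f \<sigma> \<mu> t K \<and> skew_flow f \<sigma> \<mu> t ` K = K)"

definition minimal_set ::
  "('w::metric_space \<times> real \<Rightarrow> real) \<Rightarrow> (real \<Rightarrow> 'w \<Rightarrow> 'w) \<Rightarrow> real \<Rightarrow> ('w \<times> real) set \<Rightarrow> bool" where
  "minimal_set f \<sigma> \<mu> K \<longleftrightarrow>
     K \<noteq> {} \<and> compact K \<and> invariant_set f \<sigma> \<mu> K \<and>
     \<not> (\<exists>L. L \<noteq> {} \<and> compact L \<and> invariant_set f \<sigma> \<mu> L \<and> L \<subset> K)"

definition hausdorff_semidist :: "'a::metric_space set \<Rightarrow> 'a set \<Rightarrow> ennreal" where
  "hausdorff_semidist C D = (SUP c\<in>C. INF d\<in>D. ennreal (dist c d))"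

definition attracts ::
  "('w::metric_space \<times> real \<Rightarrow> real) \<Rightarrow> (real \<Rightarrow> 'w \<Rightarrow> 'w) \<Rightarrow> real \<Rightarrow>
     ('w \<times> real) set \<Rightarrow> ('w \<times> real) set \<Rightarrow> bool" where
  "attracts f \<sigma> \<mu> A C \<longleftrightarrow>
     (\<forall>t\<ge>0. flow_defined_at f \<sigma> \<mu> t C) \<and>
     ((\<lambda>t. hausdorff_semidist (skew_flow f \<sigma> \<mu> t ` C) A) \<longlongrightarrow> 0) at_top"

definition global_attractor ::
  "('w::metric_space \<times> real \<Rightarrow> real) \<Rightarrow> (real \<Rightarrow> 'w \<Rightarrow> 'w) \<Rightarrow> real \<Rightarrow> ('w \<times> real) set \<Rightarrow> bool" where
  "global_attractor f \<sigma> \<mu> A \<longleftrightarrow>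
     compact A \<and> invariant_set f \<sigma> \<mu> A \<and> (\<forall>C. bounded C \<longrightarrow> attracts f \<sigma> \<mu> A C)"

definition pinched :: "('w \<times> real) set \<Rightarrow> bool" where
  "pinched K \<longleftrightarrow> (\<exists>\<omega>. is_singleton {x. (\<omega>, x) \<in> K})"

end

theory Submission
  imports Defs
begin

text \<open>
  \<^emph>\<open>Pinching.\<close> The boundary functions \<open>\<alpha>\<close> and \<open>\<beta>\<close> of an attractor are equilibria, that is, their
  graphs are invariant: the flow preserves the order on fibres, so it carries the lowest point of
  a fibre to the lowest point (\<open>lower_equilibrium\<close>, \<open>upper_equilibrium\<close>). Compactness makes \<open>\<alpha>\<close>
  lower and \<open>\<beta>\<close> upper semicontinuous, so by Baire they have a common continuity point \<open>\<omega>\<close>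
  (\<open>common_continuity_point\<close>). The orbit closure of \<open>(\<omega>, \<alpha> \<omega>)\<close> meets the fibre over \<open>\<omega>\<close> only in
  that point, by continuity, and this makes it a minimal set: a smaller compact invariant set
  still projects onto the whole minimal base, hence contains \<open>(\<omega>, \<alpha> \<omega>)\<close> and its orbit closure
  (\<open>equilibrium_minimal_set\<close>). The same holds for \<open>\<beta>\<close>. There is only one minimal set, so
  \<open>\<alpha> \<omega> = \<beta> \<omega>\<close>.

  \<^emph>\<open>Ordering.\<close> Let \<open>\<mu> < \<xi>\<close>. Take a complete orbit for \<open>\<xi>\<close> in its attractor, and start solutions for
  \<open>\<mu>\<close> on it ever further in the past. At time zero they lie below the orbit and approach the
  attractor for \<open>\<mu>\<close>; hence \<open>\<alpha>\<^sub>\<mu> \<le> \<alpha>\<^sub>\<xi>\<close> (\<open>attractor_below_larger_parameter\<close>), and flowing for one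
  more unit of time makes the inequality strict. At a point where the attractor for \<open>\<mu>\<close> is pinched
  this reads \<open>\<beta>\<^sub>\<mu> < \<alpha>\<^sub>\<xi>\<close>, and by semicontinuity the inequality persists on an open set \<open>U\<close>. Over a
  compact minimal base every backward semiorbit meets \<open>U\<close> (\<open>backward_orbit_meets_open\<close>), and
  \<open>\<beta>\<^sub>\<mu> < \<alpha>\<^sub>\<xi>\<close> propagates forward in time by comparison. So it holds everywhere.

  No existence theorem for solutions enters: entire solutions in the compact invariant sets exist
  by invariance, and forward solutions from bounded sets exist by attraction.
  Uniqueness and continuity of the flow both come from one Gronwall estimate.
\<close>

section \<open>Comparison for scalar differential inequalities\<close>

text \<open>A function that increases through each of its zeros cannot come back to zero: at a first return
  it would have to be positive just before a zero with positive slope.\<close>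
lemma barrier:
  fixes d d' :: "real \<Rightarrow> real"
  assumes der: "\<And>t. 0 \<le> t \<Longrightarrow> t \<le> T \<Longrightarrow> (d has_real_derivative d' t) (at t)"
    and nonneg: "0 \<le> d 0"
    and up: "\<And>t. 0 \<le> t \<Longrightarrow> t \<le> T \<Longrightarrow> d t = 0 \<Longrightarrow> 0 < d' t"
    and T: "0 < T"
  shows "0 < d T"
proof (rule ccontr)
  assume "\<not> 0 < d T"
  then have dT: "d T \<le> 0" by simp
  have cont: "continuous_on {0..T} d"
    by (rule continuous_at_imp_continuous_on) (meson DERIV_isCont atLeastAtMost_iff der)
  obtain s where s: "0 \<le> s" "s < T" "0 < d s"
  proof (cases "d 0 = 0")
    case True
    then have "0 < d' 0" using up T by auto
    from DERIV_pos_inc_right[OF der[of 0] this] T obtain e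
      where e: "e > 0" "\<And>h. h > 0 \<Longrightarrow> h < e \<Longrightarrow> d 0 < d (0 + h)" by auto
    have "0 < d (min (e/2) (T/2))"
      using e(2)[of "min (e/2) (T/2)"] e(1) T True by auto
    then show ?thesis using that[of "min (e/2) (T/2)"] e(1) T by auto
  next
    case False
    then show ?thesis using that[of 0] nonneg T by auto
  qed
  define Z where "Z = {t \<in> {s..T}. d t = 0}"
  have cont_s: "continuous_on {s..T} d"
    using cont s by (auto intro: continuous_on_subset)
  have "compact ({s..T} \<inter> ({s..T} \<inter> d -` {0}))"
    by (intro compact_Int_closed continuous_closed_preimage cont_s) auto
  moreover have "{s..T} \<inter> ({s..T} \<inter> d -` {0}) = Z" by (auto simp: Z_def)
  ultimately have "compact Z" by simp
  moreover have "Z \<noteq> {}"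
    using IVT2'[of d T 0 s] dT s cont_s by (auto simp: Z_def)
  ultimately obtain c where c: "c \<in> Z" and c_min: "\<And>t. t \<in> Z \<Longrightarrow> c \<le> t"
    by (meson compact_attains_inf)
  have c0: "d c = 0" "s \<le> c" "c \<le> T" using c by (auto simp: Z_def)
  then have "s < c" using s by (cases "s = c") auto
  have pos: "0 < d t" if t: "s \<le> t" "t < c" for t
  proof (rule ccontr)
    assume "\<not> 0 < d t"
    moreover have "continuous_on {s..t} d"
      using that c0 by (intro continuous_on_subset[OF cont_s]) auto
    ultimately obtain z where "s \<le> z" "z \<le> t" "d z = 0"
      using IVT2'[of d t 0 s] s t by auto
    then show False using c_min[of z] that c0 by (auto simp: Z_def)
  qed
  have "0 < d' c" using up c0 s by auto
  from DERIV_pos_inc_left[OF der[of c] this] c0 s obtain e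
    where e: "e > 0" "\<And>h. h > 0 \<Longrightarrow> h < e \<Longrightarrow> d (c - h) < d c" by auto
  define h where "h = min (e/2) ((c - s)/2)"
  have h: "h > 0" "h < e" "s \<le> c - h" "c - h < c"
    using e(1) \<open>s < c\<close> by (auto simp: h_def min_def field_simps)
  show False using e(2)[OF h(1,2)] pos[OF h(3,4)] c0 by simp
qed

lemma gronwall_forward:
  fixes w w' :: "real \<Rightarrow> real"
  assumes der: "\<And>t. 0 \<le> t \<Longrightarrow> t \<le> T \<Longrightarrow> (w has_real_derivative w' t) (at t)"
    and bound: "\<And>t. 0 \<le> t \<Longrightarrow> t \<le> T \<Longrightarrow> \<bar>w' t\<bar> \<le> L * \<bar>w t\<bar> + e"
    and L: "0 \<le> L" and init: "\<bar>w 0\<bar> < a" and e: "e < a" and T: "0 \<le> T"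
  shows "\<bar>w T\<bar> < a * exp ((L + 1) * T)"
proof (cases "T = 0")
  case True
  then show ?thesis using init by simp
next
  case False
  \<comment> \<open>The surplus \<open>h \<ge> a > e\<close> in the slope \<open>(L + 1) h\<close> absorbs the error \<open>e\<close>, so that \<open>h\<close> is a
      strict barrier for \<open>w\<close> and for \<open>- w\<close>.\<close>
  define h where "h = (\<lambda>t. a * exp ((L + 1) * t))"
  have h_der: "(h has_real_derivative (L + 1) * h t) (at t)" for t
    unfolding h_def by (auto intro!: derivative_eq_intros)
  have a: "0 < a" using init by linarith
  have h_ge: "a \<le> h t" if "0 \<le> t" for t
    using a L that by (simp add: h_def)
  have slope: "\<bar>w' t\<bar> < (L + 1) * h t" if "0 \<le> t" "t \<le> T" "\<bar>w t\<bar> = h t" for t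
    using bound[OF that(1,2)] h_ge[OF that(1)] e by (simp add: that(3) algebra_simps)
  have h_pos: "0 < h t" for t using a by (simp add: h_def)
  have "0 < h T - w T"
  proof (rule barrier[where d = "\<lambda>t. h t - w t" and T = T])
    show "((\<lambda>t. h t - w t) has_real_derivative (L + 1) * h t - w' t) (at t)"
      if "0 \<le> t" "t \<le> T" for t
      using h_der der[OF that] by (rule DERIV_diff)
    show "0 \<le> h 0 - w 0" using init by (simp add: h_def)
    show "0 < (L + 1) * h t - w' t" if "0 \<le> t" "t \<le> T" "h t - w t = 0" for t
      using slope[OF that(1,2)] that(3) h_pos[of t] by auto
  qed (use T False in simp)
  moreover have "0 < h T + w T"
  proof (rule barrier[where d = "\<lambda>t. h t + w t" and T = T])
    show "((\<lambda>t. h t + w t) has_real_derivative (L + 1) * h t + w' t) (at t)"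
      if "0 \<le> t" "t \<le> T" for t
      using h_der der[OF that] by (rule DERIV_add)
    show "0 \<le> h 0 + w 0" using init by (simp add: h_def)
    show "0 < (L + 1) * h t + w' t" if "0 \<le> t" "t \<le> T" "h t + w t = 0" for t
      using slope[OF that(1,2)] that(3) h_pos[of t] by auto
  qed (use T False in simp)
  ultimately show ?thesis by (simp add: h_def)
qed

text \<open>The crude rate \<open>L + 1\<close> spares the usual integral term. The error \<open>e\<close> and the initial value are
  both controlled by \<open>a\<close>, which may be taken arbitrarily small: this yields uniqueness (with
  \<open>e = 0\<close>) as well as continuous dependence.\<close>
lemma gronwall:
  fixes w w' :: "real \<Rightarrow> real"
  assumes der: "\<And>t. t \<in> closed_segment 0 T \<Longrightarrow> (w has_real_derivative w' t) (at t)"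
    and bound: "\<And>t. t \<in> closed_segment 0 T \<Longrightarrow> \<bar>w' t\<bar> \<le> L * \<bar>w t\<bar> + e"
    and L: "0 \<le> L" and init: "\<bar>w 0\<bar> < a" and e: "e < a"
  shows "\<bar>w T\<bar> < a * exp ((L + 1) * \<bar>T\<bar>)"
proof (cases "0 \<le> T")
  case True
  then have "t \<in> closed_segment 0 T" if "0 \<le> t" "t \<le> T" for t
    using that by (simp add: closed_segment_eq_real_ivl)
  then show ?thesis
    using gronwall_forward[of T w w' L e a] assms True by simp
next
  case False
  then have seg: "- t \<in> closed_segment 0 T" if "0 \<le> t" "t \<le> - T" for t
    using that by (simp add: closed_segment_eq_real_ivl)
  have "\<bar>w (- (- T))\<bar> < a * exp ((L + 1) * (- T))"
  proof (rule gronwall_forward)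
    show "((\<lambda>t. w (- t)) has_real_derivative - w' (- t)) (at t)" if "0 \<le> t" "t \<le> - T" for t
      using DERIV_mirror[of w "w' (- t)" t] der[OF seg[OF that]] by simp
    show "\<bar>- w' (- t)\<bar> \<le> L * \<bar>w (- t)\<bar> + e" if "0 \<le> t" "t \<le> - T" for t
      using bound[OF seg[OF that]] by simp
  qed (use assms False in auto)
  then show ?thesis using False by simp
qed

section \<open>Solutions of the scalar family\<close>

locale scalar_family =
  fixes \<sigma> :: "real \<Rightarrow> 'w::metric_space \<Rightarrow> 'w"
    and f :: "'w \<times> real \<Rightarrow> real"
  assumes compact_base: "compact (UNIV :: 'w set)"
    and flow: "continuous_flow \<sigma>"
    and C01: "class_C01 f"
begin

lemma flow_zero [simp]: "\<sigma> 0 \<omega> = \<omega>"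
  and flow_add: "\<sigma> (s + t) \<omega> = \<sigma> s (\<sigma> t \<omega>)"
  and flow_cont: "continuous_on UNIV (\<lambda>(t, \<omega>). \<sigma> t \<omega>)"
  using flow by (auto simp: continuous_flow_def)

lemma flow_time_cont: "continuous_on UNIV (\<sigma> t)"
proof -
  have "continuous_on UNIV ((\<lambda>(t, \<omega>). \<sigma> t \<omega>) \<circ> (\<lambda>\<omega>. (t, \<omega>)))"
    by (rule continuous_on_compose)
       (auto intro!: continuous_intros continuous_on_subset[OF flow_cont])
  then show ?thesis by (simp add: o_def)
qed

lemma f_cont: "continuous_on UNIV f"
  using C01 by (simp add: class_C01_def)

lemma lipschitz_on_strip:
  obtains L where "0 \<le> L"
    "\<And>\<omega> x y. \<bar>x\<bar> \<le> R \<Longrightarrow> \<bar>y\<bar> \<le> R \<Longrightarrow> \<bar>f (\<omega>, x) - f (\<omega>, y)\<bar> \<le> L * \<bar>x - y\<bar>"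
proof -
  obtain g where g: "\<And>\<omega> x. ((\<lambda>y. f (\<omega>, y)) has_real_derivative g (\<omega>, x)) (at x)"
    and g_cont: "continuous_on UNIV g"
    using C01 by (auto simp: class_C01_def)
  have "compact (g ` (UNIV \<times> {-R..R}))"
    by (intro compact_continuous_image compact_Times compact_base continuous_on_subset[OF g_cont])
       auto
  then obtain B where B: "\<And>\<omega> x. \<bar>x\<bar> \<le> R \<Longrightarrow> \<bar>g (\<omega>, x)\<bar> \<le> B"
    by (force dest!: compact_imp_bounded simp: bounded_iff abs_le_iff)
  show ?thesis
  proof (rule that[of "max B 0"])
    fix \<omega> x y assume xy: "\<bar>x\<bar> \<le> R" "\<bar>y\<bar> \<le> R"
    have "norm (f (\<omega>, x) - f (\<omega>, y)) \<le> max B 0 * norm (x - y)"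
    proof (rule field_differentiable_bound[where S = "{-R..R}"])
      show "((\<lambda>y. f (\<omega>, y)) has_real_derivative g (\<omega>, z)) (at z within {-R..R})" for z
        using g by (rule has_field_derivative_at_within)
      show "norm (g (\<omega>, z)) \<le> max B 0" if "z \<in> {-R..R}" for z
        using B[of z \<omega>] that by (simp add: abs_le_iff max.coboundedI1)
    qed (use xy in auto)
    then show "\<bar>f (\<omega>, x) - f (\<omega>, y)\<bar> \<le> max B 0 * \<bar>x - y\<bar>" by simp
  qed simp
qed

lemma solutions_unique:
  assumes u: "\<And>t. t \<in> closed_segment 0 T \<Longrightarrow> (u has_real_derivative f (\<sigma> t \<omega>, u t) + \<mu>) (at t)"
    and v: "\<And>t. t \<in> closed_segment 0 T \<Longrightarrow> (v has_real_derivative f (\<sigma> t \<omega>, v t) + \<mu>) (at t)"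
    and init: "u 0 = v 0"
  shows "u T = v T"
proof -
  have "compact (u ` closed_segment 0 T)" "compact (v ` closed_segment 0 T)"
    using u v by (auto intro!: compact_continuous_image continuous_at_imp_continuous_on
        intro: DERIV_isCont)
  then have "bounded (u ` closed_segment 0 T \<union> v ` closed_segment 0 T)"
    by (simp add: compact_imp_bounded)
  then obtain R where R: "\<And>t. t \<in> closed_segment 0 T \<Longrightarrow> \<bar>u t\<bar> \<le> R \<and> \<bar>v t\<bar> \<le> R"
    by (force simp: bounded_iff)
  obtain L where L: "0 \<le> L"
    "\<And>\<omega> x y. \<bar>x\<bar> \<le> R \<Longrightarrow> \<bar>y\<bar> \<le> R \<Longrightarrow> \<bar>f (\<omega>, x) - f (\<omega>, y)\<bar> \<le> L * \<bar>x - y\<bar>"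
    using lipschitz_on_strip[of R] by blast
  have small: "\<bar>u T - v T\<bar> < a * exp ((L + 1) * \<bar>T\<bar>)" if "0 < a" for a
  proof (rule gronwall)
    show "((\<lambda>t. u t - v t) has_real_derivative f (\<sigma> t \<omega>, u t) - f (\<sigma> t \<omega>, v t)) (at t)"
      if "t \<in> closed_segment 0 T" for t
      using DERIV_diff[OF u[OF that] v[OF that]] by simp
    show "\<bar>f (\<sigma> t \<omega>, u t) - f (\<sigma> t \<omega>, v t)\<bar> \<le> L * \<bar>u t - v t\<bar> + 0"
      if "t \<in> closed_segment 0 T" for t
      using L(2)[of "u t" "v t"] R[OF that] by simp
  qed (use that init L in auto)
  show ?thesis
  proof (rule ccontr)
    assume "u T \<noteq> v T"
    then show False
      using small[of "\<bar>u T - v T\<bar> / exp ((L + 1) * \<bar>T\<bar>)"] by simp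
  qed
qed

lemma max_sol_eq:
  assumes "solution_on f \<sigma> \<mu> \<omega> x J u" "t \<in> J"
  shows "max_sol f \<sigma> \<mu> t \<omega> x = u t"
  unfolding max_sol_def
proof (rule the_equality)
  show "\<exists>J u'. solution_on f \<sigma> \<mu> \<omega> x J u' \<and> t \<in> J \<and> u' t = u t"
    using assms by blast
  fix y assume "\<exists>J u. solution_on f \<sigma> \<mu> \<omega> x J u \<and> t \<in> J \<and> u t = y"
  then obtain J' v where v: "solution_on f \<sigma> \<mu> \<omega> x J' v" "t \<in> J'" "v t = y" by blast
  have "closed_segment 0 t \<subseteq> J" "closed_segment 0 t \<subseteq> J'"
    using assms v by (auto simp: solution_on_def is_interval_convex_1 closed_segment_subset)
  then have "v t = u t"
    using assms v by (intro solutions_unique[of t v \<omega> \<mu> u]) (auto simp: solution_on_def)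
  then show "y = u t" using v by simp
qed

text \<open>The initial value is left free, as \<open>u 0\<close>, so that time shifts of an entire solution are
  again entire solutions.\<close>
definition entire :: "real \<Rightarrow> 'w \<Rightarrow> (real \<Rightarrow> real) \<Rightarrow> bool" where
  "entire \<mu> \<omega> u \<longleftrightarrow> (\<forall>t. (u has_real_derivative f (\<sigma> t \<omega>, u t) + \<mu>) (at t))"

lemma entire_max_sol: "entire \<mu> \<omega> u \<Longrightarrow> max_sol f \<sigma> \<mu> t \<omega> (u 0) = u t"
  by (rule max_sol_eq[of _ _ _ UNIV]) (auto simp: entire_def solution_on_def)

lemma entire_shift:
  assumes "entire \<mu> \<omega> u"
  shows "entire \<mu> (\<sigma> s \<omega>) (\<lambda>t. u (t + s))"
  unfolding entire_def
proof
  fix t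
  have "(u has_real_derivative f (\<sigma> (t + s) \<omega>, u (t + s)) + \<mu>) (at (t + s))"
    using assms by (simp add: entire_def)
  then show "((\<lambda>t. u (t + s)) has_real_derivative f (\<sigma> t (\<sigma> s \<omega>), u (t + s)) + \<mu>) (at t)"
    by (simp add: flow_add DERIV_shift)
qed

lemma entire_cont: "entire \<mu> \<omega> u \<Longrightarrow> continuous_on S u"
  by (rule continuous_at_imp_continuous_on) (auto simp: entire_def intro: DERIV_isCont)

lemma entire_unique:
  assumes "entire \<mu> \<omega> u" "entire \<mu> \<omega> v" "u s = v s"
  shows "u t = v t"
proof -
  have "u ((t - s) + s) = v ((t - s) + s)"
    by (rule solutions_unique[of _ "\<lambda>t. u (t + s)" "\<sigma> s \<omega>" \<mu> "\<lambda>t. v (t + s)"])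
       (use entire_shift[OF assms(1), of s] entire_shift[OF assms(2), of s] assms(3)
         in \<open>auto simp: entire_def\<close>)
  then show ?thesis by simp
qed

text \<open>Two graphs that exchange their order must cross, and at a crossing the solutions coincide.
  This works in both time directions.\<close>
lemma entire_mono:
  assumes u: "entire \<mu> \<omega> u" and v: "entire \<mu> \<omega> v" and le: "u s \<le> v s"
  shows "u t \<le> v t"
proof (rule ccontr)
  assume "\<not> u t \<le> v t"
  then have "0 \<in> closed_segment (u s - v s) (u t - v t)"
    using le by (simp add: closed_segment_eq_real_ivl)
  then obtain z where "u z - v z = 0"
    using IVT'_closed_segment_real[of 0 "\<lambda>t. u t - v t" s t]
      continuous_on_diff[OF entire_cont[OF u] entire_cont[OF v]] by blast
  then have "u t = v t" using entire_unique[OF u v, of z] by simp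
  then show False using \<open>\<not> u t \<le> v t\<close> by simp
qed

text \<open>Wherever the two solutions meet, the slopes differ by exactly \<open>\<xi> - \<mu> > 0\<close>.\<close>
lemma strict_parameter_comparison:
  assumes u: "\<And>t. 0 \<le> t \<Longrightarrow> t \<le> T \<Longrightarrow> (u has_real_derivative f (\<sigma> t \<omega>, u t) + \<mu>) (at t)"
    and v: "\<And>t. 0 \<le> t \<Longrightarrow> t \<le> T \<Longrightarrow> (v has_real_derivative f (\<sigma> t \<omega>, v t) + \<xi>) (at t)"
    and "\<mu> < \<xi>" "u 0 \<le> v 0" "0 < T"
  shows "u T < v T"
proof -
  have "0 < v T - u T"
  proof (rule barrier[where d = "\<lambda>t. v t - u t" and T = T])
    show "((\<lambda>t. v t - u t) has_real_derivative
        (f (\<sigma> t \<omega>, v t) + \<xi>) - (f (\<sigma> t \<omega>, u t) + \<mu>)) (at t)" if "0 \<le> t" "t \<le> T" for t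
      using v[OF that] u[OF that] by (rule DERIV_diff)
    show "0 < (f (\<sigma> t \<omega>, v t) + \<xi>) - (f (\<sigma> t \<omega>, u t) + \<mu>)" if "v t - u t = 0" for t
    proof -
      have "v t = u t" using that by simp
      then show ?thesis using \<open>\<mu> < \<xi>\<close> by simp
    qed
  qed (use assms in auto)
  then show ?thesis by simp
qed

section \<open>Invariant sets\<close>

text \<open>Invariance includes that all solutions starting in the set are defined for all times, so the
  local pieces of the maximal solution glue to an entire one.\<close>
lemma invariant_setD:
  assumes "invariant_set f \<sigma> \<mu> K" "(\<omega>, x) \<in> K"
  shows "entire \<mu> \<omega> (\<lambda>t. max_sol f \<sigma> \<mu> t \<omega> x)"
    and "max_sol f \<sigma> \<mu> 0 \<omega> x = x"
    and "(\<sigma> t \<omega>, max_sol f \<sigma> \<mu> t \<omega> x) \<in> K"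
proof -
  let ?u = "\<lambda>t. max_sol f \<sigma> \<mu> t \<omega> x"
  have ex: "\<exists>J u. solution_on f \<sigma> \<mu> \<omega> x J u \<and> t \<in> J" for t
    using assms by (fastforce simp: invariant_set_def flow_defined_at_def max_interval_def)
  show "entire \<mu> \<omega> ?u"
    unfolding entire_def
  proof
    fix t
    obtain J u where u: "solution_on f \<sigma> \<mu> \<omega> x J u" "t \<in> J" using ex by blast
    have eq: "u s = ?u s" if "s \<in> J" for s using max_sol_eq[OF u(1) that] by simp
    have "(u has_real_derivative f (\<sigma> t \<omega>, ?u t) + \<mu>) (at t)" "open J"
      using u eq[OF u(2)] by (auto simp: solution_on_def)
    then show "(?u has_real_derivative f (\<sigma> t \<omega>, ?u t) + \<mu>) (at t)"
      using has_field_derivative_transform_within_open[of u _ t J ?u] u(2) eq by blast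
  qed
  obtain J u where "solution_on f \<sigma> \<mu> \<omega> x J u" "0 \<in> J" using ex by blast
  then show "?u 0 = x" using max_sol_eq by (auto simp: solution_on_def)
  have "skew_flow f \<sigma> \<mu> t ` K = K" using assms(1) by (simp add: invariant_set_def)
  moreover have "skew_flow f \<sigma> \<mu> t (\<omega>, x) \<in> skew_flow f \<sigma> \<mu> t ` K"
    using assms(2) by (rule imageI)
  ultimately show "(\<sigma> t \<omega>, ?u t) \<in> K" by (simp add: skew_flow_def)
qed

lemma skew_flow_add:
  assumes "invariant_set f \<sigma> \<mu> K" "p \<in> K"
  shows "skew_flow f \<sigma> \<mu> s (skew_flow f \<sigma> \<mu> t p) = skew_flow f \<sigma> \<mu> (s + t) p"
    and "skew_flow f \<sigma> \<mu> 0 p = p"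
proof -
  obtain \<omega> x where p: "p = (\<omega>, x)" by (cases p)
  note u = invariant_setD(1,2)[OF assms(1), of \<omega> x]
  have "max_sol f \<sigma> \<mu> s (\<sigma> t \<omega>) (max_sol f \<sigma> \<mu> (0 + t) \<omega> x) = max_sol f \<sigma> \<mu> (s + t) \<omega> x"
    using u assms(2) p by (intro entire_max_sol[OF entire_shift]) auto
  then show "skew_flow f \<sigma> \<mu> s (skew_flow f \<sigma> \<mu> t p) = skew_flow f \<sigma> \<mu> (s + t) p"
    by (simp add: p skew_flow_def flow_add)
  show "skew_flow f \<sigma> \<mu> 0 p = p"
    using u assms(2) by (simp add: p skew_flow_def)
qed

text \<open>Inside an invariant set the time maps are invertible, so inclusion of the images for all
  positive and negative times already gives equality.\<close>
lemma invariant_subset: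
  assumes K: "invariant_set f \<sigma> \<mu> K" and "L \<subseteq> K"
    and forw: "\<And>t p. p \<in> L \<Longrightarrow> skew_flow f \<sigma> \<mu> t p \<in> L"
  shows "invariant_set f \<sigma> \<mu> L"
  unfolding invariant_set_def
proof (intro allI conjI)
  fix t
  show "flow_defined_at f \<sigma> \<mu> t L"
    using K \<open>L \<subseteq> K\<close> by (fastforce simp: invariant_set_def flow_defined_at_def)
  show "skew_flow f \<sigma> \<mu> t ` L = L"
  proof
    show "skew_flow f \<sigma> \<mu> t ` L \<subseteq> L" using forw by blast
    show "L \<subseteq> skew_flow f \<sigma> \<mu> t ` L"
    proof
      fix p assume "p \<in> L"
      then have "p = skew_flow f \<sigma> \<mu> t (skew_flow f \<sigma> \<mu> (- t) p)"
        using skew_flow_add[OF K, of p] \<open>L \<subseteq> K\<close> by auto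
      then show "p \<in> skew_flow f \<sigma> \<mu> t ` L" using forw[OF \<open>p \<in> L\<close>] by blast
    qed
  qed
qed

text \<open>All solutions in \<open>K\<close> stay in one compact strip. There \<open>f\<close> is Lipschitz in \<open>x\<close>, and the vector
  fields over two nearby base points are uniformly close on the time segment, so Gronwall's
  estimate applies to the difference of two solutions.\<close>
lemma skew_flow_cont_on_invariant:
  assumes K: "invariant_set f \<sigma> \<mu> K" and "compact K"
  shows "continuous_on K (skew_flow f \<sigma> \<mu> T)"
proof -
  obtain R where R: "\<And>\<omega> x. (\<omega>, x) \<in> K \<Longrightarrow> \<bar>x\<bar> \<le> R"
  proof -
    have "bounded (snd ` K)" using \<open>compact K\<close> by (simp add: bounded_snd compact_imp_bounded)
    then show thesis using that by (force simp: bounded_iff)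
  qed
  obtain L where L: "0 \<le> L"
    "\<And>\<omega> x y. \<bar>x\<bar> \<le> R \<Longrightarrow> \<bar>y\<bar> \<le> R \<Longrightarrow> \<bar>f (\<omega>, x) - f (\<omega>, y)\<bar> \<le> L * \<bar>x - y\<bar>"
    using lipschitz_on_strip[of R] by blast
  define F where "F = (\<lambda>(s, \<omega>, x). f (\<sigma> s \<omega>, x))"
  have F_cont: "continuous_on UNIV F"
  proof -
    have "continuous_on UNIV (f \<circ> (\<lambda>p. ((\<lambda>(t, \<omega>). \<sigma> t \<omega>) (fst p, fst (snd p)), snd (snd p))))"
      by (intro continuous_on_compose continuous_on_Pair continuous_on_subset[OF f_cont]
          continuous_on_compose2[OF flow_cont] continuous_intros) auto
    then show ?thesis by (simp add: F_def o_def case_prod_beta)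
  qed
  have F_unif: "uniformly_continuous_on (closed_segment 0 T \<times> UNIV \<times> {-R..R}) F"
    by (intro compact_uniformly_continuous compact_Times compact_base
        continuous_on_subset[OF F_cont]) auto
  have "continuous_on K (\<lambda>p. max_sol f \<sigma> \<mu> T (fst p) (snd p))"
    unfolding continuous_on_iff
  proof (intro ballI allI impI)
    fix p and e :: real assume "p \<in> K" "0 < e"
    define a where "a = e / exp ((L + 1) * \<bar>T\<bar>)"
    have a: "0 < a" using \<open>0 < e\<close> by (simp add: a_def)
    obtain d where d: "0 < d" and
      unif: "\<And>q q'. q \<in> closed_segment 0 T \<times> UNIV \<times> {-R..R} \<Longrightarrow>
        q' \<in> closed_segment 0 T \<times> UNIV \<times> {-R..R} \<Longrightarrow> dist q' q < d \<Longrightarrow> dist (F q') (F q) < a / 2"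
      using F_unif a unfolding uniformly_continuous_on_def by (meson half_gt_zero)
    show "\<exists>d>0. \<forall>q\<in>K. dist q p < d \<longrightarrow>
      dist (max_sol f \<sigma> \<mu> T (fst q) (snd q)) (max_sol f \<sigma> \<mu> T (fst p) (snd p)) < e"
    proof (intro exI conjI ballI impI)
      show "0 < min a d" using a d by simp
      fix q assume "q \<in> K" and near: "dist q p < min a d"
      obtain \<omega> x where p: "p = (\<omega>, x)" by (cases p)
      obtain \<omega>' x' where q: "q = (\<omega>', x')" by (cases q)
      define u where "u = (\<lambda>t. max_sol f \<sigma> \<mu> t \<omega> x)"
      define v where "v = (\<lambda>t. max_sol f \<sigma> \<mu> t \<omega>' x')"
      have u: "entire \<mu> \<omega> u" "u 0 = x" "\<And>t. \<bar>u t\<bar> \<le> R"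
        using invariant_setD[OF K, of \<omega> x] \<open>p \<in> K\<close> R by (auto simp: p u_def)
      have v: "entire \<mu> \<omega>' v" "v 0 = x'" "\<And>t. \<bar>v t\<bar> \<le> R"
        using invariant_setD[OF K, of \<omega>' x'] \<open>q \<in> K\<close> R by (auto simp: q v_def)
      have dist_\<omega>: "dist \<omega>' \<omega> < d" and dist_x: "\<bar>x' - x\<bar> < a"
        using near dist_fst_le[of q p] dist_snd_le[of q p] by (auto simp: p q dist_real_def)
      have "\<bar>v T - u T\<bar> < a * exp ((L + 1) * \<bar>T\<bar>)"
      proof (rule gronwall)
        show "((\<lambda>t. v t - u t) has_real_derivative f (\<sigma> t \<omega>', v t) - f (\<sigma> t \<omega>, u t)) (at t)" for t
          using DERIV_diff[of v _ t UNIV u] u(1) v(1) unfolding entire_def by fastforce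
        fix t assume t: "t \<in> closed_segment 0 T"
        have "dist (F (t, \<omega>', u t)) (F (t, \<omega>, u t)) < a / 2"
          using t u(3)[of t] dist_\<omega> by (intro unif) (auto simp: dist_Pair_Pair abs_le_iff)
        moreover have "\<bar>f (\<sigma> t \<omega>', v t) - f (\<sigma> t \<omega>', u t)\<bar> \<le> L * \<bar>v t - u t\<bar>"
          using L(2) u(3) v(3) by blast
        ultimately show "\<bar>f (\<sigma> t \<omega>', v t) - f (\<sigma> t \<omega>, u t)\<bar> \<le> L * \<bar>v t - u t\<bar> + a / 2"
          unfolding F_def dist_real_def prod.case by linarith
      qed (use L a dist_x u v in auto)
      then show "dist (max_sol f \<sigma> \<mu> T (fst q) (snd q)) (max_sol f \<sigma> \<mu> T (fst p) (snd p)) < e"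
        by (simp add: a_def p q u_def v_def dist_real_def)
    qed
  qed
  moreover have "continuous_on K (\<lambda>p. \<sigma> T (fst p))"
    by (rule continuous_on_compose2[OF flow_time_cont]) (auto intro: continuous_intros)
  ultimately have "continuous_on K (\<lambda>p. (\<sigma> T (fst p), max_sol f \<sigma> \<mu> T (fst p) (snd p)))"
    by (intro continuous_on_Pair)
  then show ?thesis by (simp add: skew_flow_def case_prod_beta)
qed

lemma orbit_closure_invariant:
  assumes K: "invariant_set f \<sigma> \<mu> K" and "compact K" and "p \<in> K"
  defines "M \<equiv> closure (range (\<lambda>t. skew_flow f \<sigma> \<mu> t p))"
  shows "compact M" "M \<subseteq> K" "invariant_set f \<sigma> \<mu> M"
proof -
  let ?O = "range (\<lambda>t. skew_flow f \<sigma> \<mu> t p)"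
  have "?O \<subseteq> K" using K \<open>p \<in> K\<close> unfolding invariant_set_def by blast
  then show MK: "M \<subseteq> K"
    unfolding M_def by (simp add: closure_minimal compact_imp_closed[OF \<open>compact K\<close>])
  then show "compact M"
    using compact_Int_closed[OF \<open>compact K\<close>, of M] by (simp add: M_def Int_absorb1)
  show "invariant_set f \<sigma> \<mu> M"
  proof (rule invariant_subset[OF K MK])
    fix t q assume "q \<in> M"
    have "skew_flow f \<sigma> \<mu> t ` closure ?O \<subseteq> closure ?O"
    proof (rule image_closure_subset)
      show "continuous_on (closure ?O) (skew_flow f \<sigma> \<mu> t)"
        using continuous_on_subset[OF skew_flow_cont_on_invariant[OF K \<open>compact K\<close>] MK]
        unfolding M_def .
      show "skew_flow f \<sigma> \<mu> t ` ?O \<subseteq> closure ?O"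
        using skew_flow_add(1)[OF K \<open>p \<in> K\<close>] closure_subset[of ?O] by fastforce
    qed simp
    then show "skew_flow f \<sigma> \<mu> t q \<in> M" using \<open>q \<in> M\<close> unfolding M_def by blast
  qed
qed

text \<open>The semidistance of a point to the empty set is infinite, hence does not tend to zero.\<close>
lemma global_attractor_nonempty:
  assumes "global_attractor f \<sigma> \<mu> B"
  shows "B \<noteq> {}"
proof
  assume "B = {}"
  fix p :: "'w \<times> real"
  have "attracts f \<sigma> \<mu> B {p}" using assms by (simp add: global_attractor_def)
  then have "((\<lambda>t::real. \<infinity> :: ennreal) \<longlongrightarrow> 0) at_top"
    by (simp add: attracts_def hausdorff_semidist_def \<open>B = {}\<close>)
  then show False by (simp add: tendsto_const_iff)
qed

text \<open>Pullback attraction. For \<open>t > 0\<close> move \<open>(\<omega>, x)\<close> back to time \<open>- t\<close> by the flow for \<open>\<xi>\<close>, staying in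
  \<open>K\<close>, and then forward again by the flow for \<open>\<mu>\<close>. The result lies in the fibre of \<open>\<omega>\<close> below \<open>x\<close>; for
  large \<open>t\<close> it is close to \<open>B\<close>, uniformly because \<open>K\<close> is bounded.\<close>
lemma attractor_below_larger_parameter:
  assumes B: "global_attractor f \<sigma> \<mu> B" and K: "invariant_set f \<sigma> \<xi> K" and "compact K"
    and "\<mu> < \<xi>" and "(\<omega>, x) \<in> K"
  shows "\<exists>y\<le>x. (\<omega>, y) \<in> B"
proof (rule ccontr)
  assume none: "\<not> (\<exists>y\<le>x. (\<omega>, y) \<in> B)"
  \<comment> \<open>Otherwise the compact set \<open>B\<close> has a positive distance \<open>d\<close> to the half-line \<open>S\<close>.\<close>
  define S where "S = {\<omega>} \<times> {..x}"
  have "compact B" using B by (simp add: global_attractor_def)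
  moreover have "continuous_on B (\<lambda>b. infdist b S)" by (intro continuous_intros)
  ultimately obtain b\<^sub>0 where b\<^sub>0: "b\<^sub>0 \<in> B" "\<And>b. b \<in> B \<Longrightarrow> infdist b\<^sub>0 S \<le> infdist b S"
    using continuous_attains_inf[OF _ global_attractor_nonempty[OF B]] by blast
  define d where "d = infdist b\<^sub>0 S"
  have "closed S" "S \<noteq> {}" unfolding S_def by (auto intro: closed_Times)
  moreover have "b\<^sub>0 \<notin> S" using none b\<^sub>0(1) by (auto simp: S_def)
  ultimately have "0 < d"
    using in_closed_iff_infdist_zero[of S b\<^sub>0] infdist_nonneg[of b\<^sub>0 S] by (simp add: d_def less_le)
  have att: "attracts f \<sigma> \<mu> B K"
    using B \<open>compact K\<close> by (auto simp: global_attractor_def dest: compact_imp_bounded)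
  then have "eventually (\<lambda>t. hausdorff_semidist (skew_flow f \<sigma> \<mu> t ` K) B < ennreal d) at_top"
    unfolding attracts_def using \<open>0 < d\<close> by (auto intro: order_tendstoD)
  then have "eventually (\<lambda>t. 0 < t \<and> hausdorff_semidist (skew_flow f \<sigma> \<mu> t ` K) B < ennreal d) at_top"
    using eventually_gt_at_top[of 0] by eventually_elim auto
  then obtain t where t: "0 < t" "hausdorff_semidist (skew_flow f \<sigma> \<mu> t ` K) B < ennreal d"
    by (auto simp: eventually_at_top_linorder)
  define v where "v = (\<lambda>s. max_sol f \<sigma> \<xi> s \<omega> x)"
  note v = invariant_setD[OF K \<open>(\<omega>, x) \<in> K\<close>, folded v_def]
  have start: "(\<sigma> (- t) \<omega>, v (- t)) \<in> K" using v(3) by (simp add: v_def)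
  have "flow_defined_at f \<sigma> \<mu> t K" using att t(1) by (simp add: attracts_def)
  then have "t \<in> max_interval f \<sigma> \<mu> (\<sigma> (- t) \<omega>) (v (- t))"
    using bspec[OF _ start] unfolding flow_defined_at_def by fast
  then obtain J u where u: "solution_on f \<sigma> \<mu> (\<sigma> (- t) \<omega>) (v (- t)) J u" "t \<in> J"
    by (auto simp: max_interval_def)
  have J: "s \<in> J" if "0 \<le> s" "s \<le> t" for s
    using u that mem_is_interval_1_I[of J 0 t s] by (auto simp: solution_on_def)
  have "u t < v (t + - t)"
  proof (rule strict_parameter_comparison
      [where u = u and v = "\<lambda>s. v (s + - t)" and T = t and \<omega> = "\<sigma> (- t) \<omega>"])
    show "(u has_real_derivative f (\<sigma> s (\<sigma> (- t) \<omega>), u s) + \<mu>) (at s)" if "0 \<le> s" "s \<le> t" for s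
      using u(1) J[OF that] by (simp add: solution_on_def)
    show "((\<lambda>s. v (s + - t)) has_real_derivative f (\<sigma> s (\<sigma> (- t) \<omega>), v (s + - t)) + \<xi>) (at s)" for s
      using entire_shift[OF v(1), of "- t"] unfolding entire_def by blast
  qed (use u t \<open>\<mu> < \<xi>\<close> in \<open>auto simp: solution_on_def\<close>)
  then have "u t < x" using v(2) by (simp add: v_def)
  moreover have "skew_flow f \<sigma> \<mu> t (\<sigma> (- t) \<omega>, v (- t)) = (\<omega>, u t)"
    using max_sol_eq[OF u] flow_add[of t "- t" \<omega>] by (simp add: skew_flow_def)
  ultimately have "(\<omega>, u t) \<in> skew_flow f \<sigma> \<mu> t ` K" "(\<omega>, u t) \<in> S"
    using start unfolding S_def by (force, simp)
  then have "(INF b\<in>B. ennreal (dist (\<omega>, u t) b)) < ennreal d"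
    using t(2) unfolding hausdorff_semidist_def by (meson SUP_upper le_less_trans)
  then obtain b where "b \<in> B" "ennreal (dist (\<omega>, u t) b) < ennreal d"
    by (auto simp: Inf_less_iff)
  then have "dist b (\<omega>, u t) < d" by (simp add: dist_commute ennreal_less_iff)
  moreover have "d \<le> dist b (\<omega>, u t)"
    using b\<^sub>0(2)[OF \<open>b \<in> B\<close>] infdist_le[OF \<open>(\<omega>, u t) \<in> S\<close>, of b] by (simp add: d_def)
  ultimately show False by simp
qed

end

section \<open>Semicontinuous functions on a compact space\<close>

text \<open>Lower semicontinuity gives one half of continuity. For the other half, a rational \<open>q\<close> slightly
  above \<open>g \<omega>\<close> has \<open>\<omega>\<close> in the sublevel set of \<open>q\<close>, and off the frontier this means in its interior.\<close>
lemma isCont_outside_frontiers: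
  fixes g :: "'a::metric_space \<Rightarrow> real"
  assumes lsc: "\<And>c. closed {\<omega>. g \<omega> \<le> c}"
    and out: "\<And>q. q \<in> \<rat> \<Longrightarrow> \<omega> \<notin> frontier {\<omega>. g \<omega> \<le> q}"
  shows "isCont g \<omega>"
  unfolding isCont_def
proof (rule order_tendstoI)
  fix c assume "c < g \<omega>"
  moreover have "open (- {\<omega>. g \<omega> \<le> c})" using lsc by (simp add: open_Compl)
  ultimately show "eventually (\<lambda>x. c < g x) (at \<omega>)"
    unfolding eventually_at_topological
    by (intro exI[of _ "- {\<omega>. g \<omega> \<le> c}"]) auto
next
  fix c assume "g \<omega> < c"
  then obtain q where q: "q \<in> \<rat>" "g \<omega> < q" "q < c" using Rats_dense_in_real by blast
  have "\<omega> \<in> closure {\<omega>. g \<omega> \<le> q}" using q by (intro subsetD[OF closure_subset]) simp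
  then have "\<omega> \<in> interior {\<omega>. g \<omega> \<le> q}"
    using out[OF q(1)] unfolding frontier_def by simp
  moreover have "g x < c" if "x \<in> interior {\<omega>. g \<omega> \<le> q}" for x
    using subsetD[OF interior_subset that] q(3) by simp
  ultimately show "eventually (\<lambda>x. g x < c) (at \<omega>)"
    unfolding eventually_at_topological
    by (intro exI[of _ "interior {\<omega>. g \<omega> \<le> q}"]) auto
qed

text \<open>The frontiers of the closed sublevel sets at rational levels are countably many closed
  nowhere dense sets; by Baire they do not cover the space.\<close>
lemma common_continuity_point:
  fixes g h :: "'a::metric_space \<Rightarrow> real"
  assumes "compact (UNIV :: 'a set)"
    and lsc: "\<And>c. closed {\<omega>. g \<omega> \<le> c}" "\<And>c. closed {\<omega>. h \<omega> \<le> c}"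
  obtains \<omega> where "isCont g \<omega>" "isCont h \<omega>"
proof -
  define G where "G = (\<lambda>q. frontier {\<omega>. g \<omega> \<le> q}) ` \<rat> \<union> (\<lambda>q. frontier {\<omega>. h \<omega> \<le> q}) ` \<rat>"
  have nowhere_dense: "interior (frontier S) = {}" if "closed S" for S :: "'a set"
    using interior_mono[OF frontier_subset_closed[OF that]] interior_subset[of "frontier S"]
    by (auto simp: frontier_def)
  have "(euclidean :: 'a topology) interior_of \<Union>G = {}"
  proof (rule Baire_category_alt)
    have "locally_compact_space (euclidean :: 'a topology)"
      using assms(1) by (intro compact_imp_locally_compact_space) (simp add: compact_space_def)
    moreover have "regular_space (euclidean :: 'a topology)"
      using metrizable_imp_regular_space[OF Met_TC.metrizable_space_mtopology] by simp
    ultimately show "completely_metrizable_space (euclidean :: 'a topology) \<or>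
      locally_compact_space (euclidean :: 'a topology) \<and> regular_space (euclidean :: 'a topology)"
      by simp
    show "countable G" unfolding G_def using countable_rat by blast
    show "closedin euclidean S \<and> (euclidean :: 'a topology) interior_of S = {}" if "S \<in> G" for S
      using that lsc by (auto simp: G_def nowhere_dense simp flip: closed_closedin)
  qed
  then obtain \<omega> where "\<omega> \<notin> \<Union>G" by (metis UNIV_eq_I interior_UNIV euclidean_interior_of UNIV_not_empty)
  then have "isCont g \<omega>" "isCont h \<omega>"
    by (auto intro!: isCont_outside_frontiers lsc simp: G_def)
  then show thesis by (rule that)
qed

section \<open>Invariant strips over a minimal base\<close>

locale invariant_strip = scalar_family \<sigma> f
  for \<sigma> :: "real \<Rightarrow> 'w::metric_space \<Rightarrow> 'w" and f :: "'w \<times> real \<Rightarrow> real" +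
  fixes \<mu> :: real and A :: "('w \<times> real) set" and \<alpha> \<beta> :: "'w \<Rightarrow> real"
  assumes minimal_base: "minimal_flow \<sigma>"
    and strip_invariant: "invariant_set f \<sigma> \<mu> A"
    and strip_compact: "compact A"
    and strip_nonempty: "A \<noteq> {}"
    and strip_eq: "A = (\<Union>\<omega>. {\<omega>} \<times> {\<alpha> \<omega>..\<beta> \<omega>})"
begin

lemma strip_iff: "(\<omega>, x) \<in> A \<longleftrightarrow> \<alpha> \<omega> \<le> x \<and> x \<le> \<beta> \<omega>"
  by (auto simp: strip_eq)

text \<open>The projection is closed and contains a full orbit of the base, which is dense.\<close>
lemma invariant_projects_onto_base:
  assumes "invariant_set f \<sigma> \<mu> K" "compact K" "K \<noteq> {}"
  shows "\<exists>x. (\<omega>, x) \<in> K"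
proof -
  obtain \<omega>\<^sub>0 x\<^sub>0 where "(\<omega>\<^sub>0, x\<^sub>0) \<in> K" using assms(3) by auto
  then have "range (\<lambda>t. \<sigma> t \<omega>\<^sub>0) \<subseteq> fst ` K"
    using invariant_setD(3)[OF assms(1)] by force
  moreover have "closed (fst ` K)"
    using assms(2) by (intro compact_imp_closed compact_continuous_image continuous_intros)
  ultimately have "closure (range (\<lambda>t. \<sigma> t \<omega>\<^sub>0)) \<subseteq> fst ` K" by (rule closure_minimal)
  then show ?thesis using minimal_base by (force simp: minimal_flow_def)
qed

lemma lower_le_upper: "\<alpha> \<omega> \<le> \<beta> \<omega>"
  using invariant_projects_onto_base[OF strip_invariant strip_compact strip_nonempty, of \<omega>]
  by (auto simp: strip_iff)

lemma lower_in: "(\<omega>, \<alpha> \<omega>) \<in> A" and upper_in: "(\<omega>, \<beta> \<omega>) \<in> A"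
  using lower_le_upper by (auto simp: strip_iff)

lemma lower_lsc: "closed {\<omega>. \<alpha> \<omega> \<le> c}"
proof -
  have "{\<omega>. \<alpha> \<omega> \<le> c} = fst ` (A \<inter> (UNIV \<times> {..c}))"
    using lower_in by (force simp: strip_iff)
  moreover have "compact (fst ` (A \<inter> (UNIV \<times> {..c})))"
    by (intro compact_continuous_image compact_Int_closed strip_compact closed_Times
        continuous_intros)
  ultimately show ?thesis by (simp add: compact_imp_closed)
qed

lemma upper_usc: "closed {\<omega>. c \<le> \<beta> \<omega>}"
proof -
  have "{\<omega>. c \<le> \<beta> \<omega>} = fst ` (A \<inter> (UNIV \<times> {c..}))"
    using upper_in by (force simp: strip_iff)
  moreover have "compact (fst ` (A \<inter> (UNIV \<times> {c..})))"
    by (intro compact_continuous_image compact_Int_closed strip_compact closed_Times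
        continuous_intros)
  ultimately show ?thesis by (simp add: compact_imp_closed)
qed

lemma strip_entire:
  assumes "(\<omega>, x) \<in> A"
  obtains u where "entire \<mu> \<omega> u" "u 0 = x" "\<And>t. (\<sigma> t \<omega>, u t) \<in> A"
    "\<And>t. skew_flow f \<sigma> \<mu> t (\<omega>, x) = (\<sigma> t \<omega>, u t)"
  using that[of "\<lambda>t. max_sol f \<sigma> \<mu> t \<omega> x"] invariant_setD[OF strip_invariant assms]
  by (auto simp: skew_flow_def)

text \<open>The time map carries the fibre over \<open>\<omega>\<close> onto the fibre over \<open>\<sigma> t \<omega>\<close> and preserves the order,
  so lowest points correspond to lowest points.\<close>
lemma lower_equilibrium: "skew_flow f \<sigma> \<mu> t (\<omega>, \<alpha> \<omega>) = (\<sigma> t \<omega>, \<alpha> (\<sigma> t \<omega>))"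
proof -
  obtain u where u: "entire \<mu> \<omega> u" "u 0 = \<alpha> \<omega>" "\<And>t. (\<sigma> t \<omega>, u t) \<in> A"
    "\<And>t. skew_flow f \<sigma> \<mu> t (\<omega>, \<alpha> \<omega>) = (\<sigma> t \<omega>, u t)"
    using strip_entire[OF lower_in] by blast
  obtain v where v: "entire \<mu> (\<sigma> t \<omega>) v" "v 0 = \<alpha> (\<sigma> t \<omega>)" "\<And>s. (\<sigma> s (\<sigma> t \<omega>), v s) \<in> A"
    using strip_entire[OF lower_in] by blast
  have "u (- t + t) \<le> v (- t)"
    using v(3)[of "- t"] u(2) flow_add[of "- t" t \<omega>] by (simp add: strip_iff)
  then have "u (0 + t) \<le> v 0" by (rule entire_mono[OF entire_shift[OF u(1)] v(1)])
  moreover have "\<alpha> (\<sigma> t \<omega>) \<le> u t" using u(3) by (simp add: strip_iff)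
  ultimately show ?thesis using u(4) v(2) by simp
qed

lemma upper_equilibrium: "skew_flow f \<sigma> \<mu> t (\<omega>, \<beta> \<omega>) = (\<sigma> t \<omega>, \<beta> (\<sigma> t \<omega>))"
proof -
  obtain u where u: "entire \<mu> \<omega> u" "u 0 = \<beta> \<omega>" "\<And>t. (\<sigma> t \<omega>, u t) \<in> A"
    "\<And>t. skew_flow f \<sigma> \<mu> t (\<omega>, \<beta> \<omega>) = (\<sigma> t \<omega>, u t)"
    using strip_entire[OF upper_in] by blast
  obtain v where v: "entire \<mu> (\<sigma> t \<omega>) v" "v 0 = \<beta> (\<sigma> t \<omega>)" "\<And>s. (\<sigma> s (\<sigma> t \<omega>), v s) \<in> A"
    using strip_entire[OF upper_in] by blast
  have "v (- t) \<le> u (- t + t)"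
    using v(3)[of "- t"] u(2) flow_add[of "- t" t \<omega>] by (simp add: strip_iff)
  then have "v 0 \<le> u (0 + t)" by (rule entire_mono[OF v(1) entire_shift[OF u(1)]])
  moreover have "u t \<le> \<beta> (\<sigma> t \<omega>)" using u(3) by (simp add: strip_iff)
  ultimately show ?thesis using u(4) v(2) by simp
qed

text \<open>The minimal set is the orbit closure of \<open>(\<omega>, e \<omega>)\<close>. The orbit runs in the graph of \<open>e\<close>, so
  continuity at \<open>\<omega>\<close> leaves \<open>e \<omega>\<close> as the only possible limit over \<open>\<omega>\<close>. Every nonempty compact invariant
  subset has a point over \<open>\<omega>\<close>, which must be \<open>(\<omega>, e \<omega>)\<close>, and then contains the whole orbit closure.\<close>
lemma equilibrium_minimal_set:
  assumes graph: "\<And>\<omega>. (\<omega>, e \<omega>) \<in> A"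
    and equi: "\<And>t \<omega>. skew_flow f \<sigma> \<mu> t (\<omega>, e \<omega>) = (\<sigma> t \<omega>, e (\<sigma> t \<omega>))"
    and cont: "isCont e \<omega>"
  shows "\<exists>M. minimal_set f \<sigma> \<mu> M \<and> (\<forall>x. (\<omega>, x) \<in> M \<longleftrightarrow> x = e \<omega>)"
proof (intro exI conjI allI iffI)
  define M where "M = closure (range (\<lambda>t. skew_flow f \<sigma> \<mu> t (\<omega>, e \<omega>)))"
  note M = orbit_closure_invariant[OF strip_invariant strip_compact graph[of \<omega>], folded M_def]
  have "skew_flow f \<sigma> \<mu> 0 (\<omega>, e \<omega>) \<in> M"
    unfolding M_def by (intro subsetD[OF closure_subset] rangeI)
  then have base: "(\<omega>, e \<omega>) \<in> M" by (simp add: equi)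
  have fibre: "x = e \<omega>" if "(\<omega>, x) \<in> M" for x
  proof -
    obtain p where p: "\<And>n. p n \<in> range (\<lambda>t. skew_flow f \<sigma> \<mu> t (\<omega>, e \<omega>))"
      "p \<longlonglongrightarrow> (\<omega>, x)"
      using \<open>(\<omega>, x) \<in> M\<close> unfolding M_def closure_sequential by blast
    have "(\<lambda>n. fst (p n)) \<longlonglongrightarrow> \<omega>" "(\<lambda>n. snd (p n)) \<longlonglongrightarrow> x"
      using tendsto_fst[OF p(2)] tendsto_snd[OF p(2)] by auto
    moreover have "snd (p n) = e (fst (p n))" for n
      using p(1)[of n] by (auto simp: equi)
    moreover have "(\<lambda>n. e (fst (p n))) \<longlonglongrightarrow> e \<omega>"
      using cont \<open>(\<lambda>n. fst (p n)) \<longlonglongrightarrow> \<omega>\<close> by (rule isCont_tendsto_compose)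
    ultimately show ?thesis by (simp add: LIMSEQ_unique)
  qed
  show "minimal_set f \<sigma> \<mu> M"
    unfolding minimal_set_def
  proof (intro conjI notI)
    show "M = {} \<Longrightarrow> False" using base by simp
    show "compact M" "invariant_set f \<sigma> \<mu> M" using M by auto
    assume "\<exists>L. L \<noteq> {} \<and> compact L \<and> invariant_set f \<sigma> \<mu> L \<and> L \<subset> M"
    then obtain L where L: "L \<noteq> {}" "compact L" "invariant_set f \<sigma> \<mu> L" "L \<subset> M" by blast
    obtain x where "(\<omega>, x) \<in> L" using invariant_projects_onto_base[OF L(3,2,1)] by blast
    then have "(\<omega>, e \<omega>) \<in> L" using fibre L(4) by blast
    then have "M \<subseteq> L"
      using orbit_closure_invariant(2)[OF L(3,2)] unfolding M_def by blast
    then show False using L(4) by blast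
  qed
  show "(\<omega>, x) \<in> M \<Longrightarrow> x = e \<omega>" for x by (rule fibre)
  show "x = e \<omega> \<Longrightarrow> (\<omega>, x) \<in> M" for x using base by simp
qed

text \<open>At a common continuity point of \<open>\<alpha>\<close> and \<open>\<beta>\<close>, both values must be the fibre of the same
  minimal set.\<close>
lemma unique_minimal_imp_pinched:
  assumes "\<exists>!M. minimal_set f \<sigma> \<mu> M"
  shows "\<exists>\<omega>. \<alpha> \<omega> = \<beta> \<omega>"
proof -
  have "closed {\<omega>. - \<beta> \<omega> \<le> c}" for c
    using upper_usc[of "- c"] by (simp add: minus_le_iff)
  then obtain \<omega> where "isCont \<alpha> \<omega>" "isCont (\<lambda>\<omega>. - \<beta> \<omega>) \<omega>"
    using common_continuity_point[OF compact_base lower_lsc, of "\<lambda>\<omega>. - \<beta> \<omega>"] by blast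
  then have "isCont \<alpha> \<omega>" "isCont \<beta> \<omega>"
    using isCont_minus[of \<omega> "\<lambda>\<omega>. - \<beta> \<omega>"] by auto
  then have "\<exists>M. minimal_set f \<sigma> \<mu> M \<and> (\<forall>x. (\<omega>, x) \<in> M \<longleftrightarrow> x = \<alpha> \<omega>)"
    "\<exists>M. minimal_set f \<sigma> \<mu> M \<and> (\<forall>x. (\<omega>, x) \<in> M \<longleftrightarrow> x = \<beta> \<omega>)"
    using equilibrium_minimal_set lower_in lower_equilibrium upper_in upper_equilibrium by auto
  then show ?thesis using assms by metis
qed

text \<open>Minimality gives density of full orbits only. A limit point \<open>z\<close> of the backward semiorbit has
  an orbit that meets \<open>U\<close> at some time \<open>s\<close>; the semiorbit passes near \<open>z\<close> at arbitrarily negative times,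
  and by continuity it is in \<open>U\<close> after a further time \<open>s\<close>, which still is a negative time.\<close>
lemma backward_orbit_meets_open:
  assumes "open U" "U \<noteq> {}"
  shows "\<exists>t<0. \<sigma> t \<omega> \<in> U"
proof -
  obtain z r where r: "strict_mono (r :: nat \<Rightarrow> nat)"
    "((\<lambda>n. \<sigma> (- real n) \<omega>) \<circ> r) \<longlonglongrightarrow> z"
    using compact_base unfolding compact_def by (metis UNIV_I)
  have "U \<inter> closure (range (\<lambda>s. \<sigma> s z)) \<noteq> {}"
    using assms minimal_base by (simp add: minimal_flow_def)
  then obtain s where s: "\<sigma> s z \<in> U"
    using open_Int_closure_eq_empty[OF assms(1)] by blast
  have "isCont (\<sigma> s) z" using flow_time_cont by (simp add: continuous_on_eq_continuous_at)
  then have "(\<lambda>n. \<sigma> s (\<sigma> (- real (r n)) \<omega>)) \<longlonglongrightarrow> \<sigma> s z"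
    using isCont_tendsto_compose[OF _ r(2)] by (simp add: o_def)
  then have "eventually (\<lambda>n. \<sigma> s (\<sigma> (- real (r n)) \<omega>) \<in> U) sequentially"
    using assms(1) s by (rule topological_tendstoD)
  moreover have "eventually (\<lambda>n. s < real (r n)) sequentially"
    using filterlim_compose[OF filterlim_real_sequentially filterlim_subseq[OF r(1)]]
    by (simp add: filterlim_at_top_dense)
  ultimately have "eventually (\<lambda>n. \<sigma> (s - real (r n)) \<omega> \<in> U \<and> s - real (r n) < 0) sequentially"
    by eventually_elim (simp flip: flow_add)
  then obtain n where "\<sigma> (s - real (r n)) \<omega> \<in> U" "s - real (r n) < 0"
    by (metis (no_types, lifting) eventually_happens' sequentially_bot)
  then show ?thesis by blast
qed

end

section \<open>Pinching and ordering of the attractors\<close>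

theorem theorem5p14:
  fixes \<sigma> :: "real \<Rightarrow> 'w::metric_space \<Rightarrow> 'w"
    and f :: "'w \<times> real \<Rightarrow> real"
    and \<A> :: "real \<Rightarrow> ('w \<times> real) set"
    and \<alpha> \<beta> :: "real \<Rightarrow> 'w \<Rightarrow> real"
  assumes "compact (UNIV :: 'w set)"
    and "continuous_flow \<sigma>"
    and "minimal_flow \<sigma>"
    and "class_C01 f"
    and "coercive f"
    and "\<forall>\<mu>. \<exists>!M. minimal_set f \<sigma> \<mu> M"
    and "\<forall>\<mu>. global_attractor f \<sigma> \<mu> (\<A> \<mu>)"
    and "\<forall>\<mu>. \<A> \<mu> = (\<Union>\<omega>. {\<omega>} \<times> {\<alpha> \<mu> \<omega>..\<beta> \<mu> \<omega>})"
  shows "(\<forall>\<mu>. pinched (\<A> \<mu>)) \<and>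
         (\<forall>\<mu> \<xi>. \<mu> < \<xi> \<longrightarrow> (\<forall>\<omega>. \<beta> \<mu> \<omega> < \<alpha> \<xi> \<omega>))"
proof -
  interpret scalar_family \<sigma> f using assms by unfold_locales
  have strip: "invariant_strip \<sigma> f \<mu> (\<A> \<mu>) (\<alpha> \<mu>) (\<beta> \<mu>)" for \<mu>
  proof
    have att: "global_attractor f \<sigma> \<mu> (\<A> \<mu>)" using assms(7) by blast
    then show "\<A> \<mu> \<noteq> {}" by (rule global_attractor_nonempty)
    show "compact (\<A> \<mu>)" "invariant_set f \<sigma> \<mu> (\<A> \<mu>)"
      using att unfolding global_attractor_def by blast+
    show "\<A> \<mu> = (\<Union>\<omega>. {\<omega>} \<times> {\<alpha> \<mu> \<omega>..\<beta> \<mu> \<omega>})" using assms(8) by (rule spec)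
  qed (rule assms(3))
  have pinch: "\<exists>\<omega>. \<alpha> \<mu> \<omega> = \<beta> \<mu> \<omega>" for \<mu>
    by (rule invariant_strip.unique_minimal_imp_pinched[OF strip spec[OF assms(6)]])
  have "pinched (\<A> \<mu>)" for \<mu>
  proof -
    obtain \<omega> where "\<alpha> \<mu> \<omega> = \<beta> \<mu> \<omega>" using pinch by blast
    then have "{x. (\<omega>, x) \<in> \<A> \<mu>} = {\<alpha> \<mu> \<omega>}"
      by (auto simp: invariant_strip.strip_iff[OF strip])
    then show ?thesis unfolding pinched_def by (metis is_singletonI)
  qed
  moreover have "\<beta> \<mu> \<omega> < \<alpha> \<xi> \<omega>" if "\<mu> < \<xi>" for \<mu> \<xi> \<omega>
  proof -
    interpret lo: invariant_strip \<sigma> f \<mu> "\<A> \<mu>" "\<alpha> \<mu>" "\<beta> \<mu>" by (rule strip)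
    interpret hi: invariant_strip \<sigma> f \<xi> "\<A> \<xi>" "\<alpha> \<xi>" "\<beta> \<xi>" by (rule strip)
    \<comment> \<open>Order between the two attractors is preserved forward in time and becomes strict.\<close>
    have forward: "x' < y'"
      if p: "(\<omega>', x) \<in> \<A> \<mu>" and q: "(\<omega>', y) \<in> \<A> \<xi>" and "x \<le> y" "0 < t"
        and p': "skew_flow f \<sigma> \<mu> t (\<omega>', x) = (\<sigma> t \<omega>', x')"
        and q': "skew_flow f \<sigma> \<xi> t (\<omega>', y) = (\<sigma> t \<omega>', y')" for \<omega>' x y x' y' t
    proof -
      obtain u where u: "entire \<mu> \<omega>' u" "u 0 = x" "\<And>t. skew_flow f \<sigma> \<mu> t (\<omega>', x) = (\<sigma> t \<omega>', u t)"
        using lo.strip_entire[OF p] by blast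
      obtain v where v: "entire \<xi> \<omega>' v" "v 0 = y" "\<And>t. skew_flow f \<sigma> \<xi> t (\<omega>', y) = (\<sigma> t \<omega>', v t)"
        using hi.strip_entire[OF q] by blast
      have "u t < v t"
      proof (rule strict_parameter_comparison[OF _ _ \<open>\<mu> < \<xi>\<close> _ \<open>0 < t\<close>])
        show "(u has_real_derivative f (\<sigma> s \<omega>', u s) + \<mu>) (at s)"
          "(v has_real_derivative f (\<sigma> s \<omega>', v s) + \<xi>) (at s)" for s
          using u(1) v(1) unfolding entire_def by blast+
        show "u 0 \<le> v 0" using u(2) v(2) \<open>x \<le> y\<close> by simp
      qed
      then show ?thesis using u(3)[of t] v(3)[of t] p' q' by simp
    qed
    have lower_le: "\<alpha> \<mu> \<omega>' \<le> \<alpha> \<xi> \<omega>'" for \<omega>'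
    proof -
      obtain y where "y \<le> \<alpha> \<xi> \<omega>'" "(\<omega>', y) \<in> \<A> \<mu>"
        using attractor_below_larger_parameter[OF spec[OF assms(7)] hi.strip_invariant
            hi.strip_compact \<open>\<mu> < \<xi>\<close> hi.lower_in] by blast
      then show ?thesis by (simp add: lo.strip_iff)
    qed
    \<comment> \<open>Start one time unit earlier, where the weak inequality is already known.\<close>
    have lower_less: "\<alpha> \<mu> \<omega>' < \<alpha> \<xi> \<omega>'" for \<omega>'
    proof -
      have "\<sigma> 1 (\<sigma> (- 1) \<omega>') = \<omega>'" using flow_add[of 1 "- 1" \<omega>'] by simp
      then show ?thesis
        using forward[OF lo.lower_in hi.lower_in lower_le zero_less_one
            lo.lower_equilibrium hi.lower_equilibrium, of "\<sigma> (- 1) \<omega>'"] by simp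
    qed
    obtain \<omega>\<^sub>0 where "\<alpha> \<mu> \<omega>\<^sub>0 = \<beta> \<mu> \<omega>\<^sub>0" using pinch by blast
    then have "\<beta> \<mu> \<omega>\<^sub>0 < \<alpha> \<xi> \<omega>\<^sub>0" using lower_less[of \<omega>\<^sub>0] by simp
    then obtain c where c: "\<beta> \<mu> \<omega>\<^sub>0 < c" "c < \<alpha> \<xi> \<omega>\<^sub>0" using dense by blast
    define U where "U = - {\<omega>. c \<le> \<beta> \<mu> \<omega>} \<inter> - {\<omega>. \<alpha> \<xi> \<omega> \<le> c}"
    have "open U" unfolding U_def
      by (intro open_Int open_Compl lo.upper_usc hi.lower_lsc)
    moreover have "\<omega>\<^sub>0 \<in> U" using c by (simp add: U_def)
    ultimately obtain t where t: "t < 0" "\<sigma> t \<omega> \<in> U"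
      using lo.backward_orbit_meets_open by blast
    then have le: "\<beta> \<mu> (\<sigma> t \<omega>) \<le> \<alpha> \<xi> (\<sigma> t \<omega>)" by (simp add: U_def)
    have "\<sigma> (- t) (\<sigma> t \<omega>) = \<omega>" using flow_add[of "- t" t \<omega>] by simp
    then show ?thesis
      using forward[OF lo.upper_in hi.lower_in le _ lo.upper_equilibrium hi.lower_equilibrium,
          of "- t"] t(1) by simp
  qed
  ultimately show ?thesis by blast
qed

end
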